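(* Let $S=\langle a_1,\dots,a_k\rangle\subset\mathbb{Z}_{\ge 0}$ be a numerical monoid with $a_i\neq 0$ for all $i$, let $j\in\{1,\dots,k\}$, and let $\prec_j$ be an Apéry ordering with respect to $a_j$ on $\mathbb{Q}[x,y_1,\dots,y_k]$. Then $$\Delta_{\prec_j}(S,a_j)=Ap(S,a_j).$$
   Context: A numerical monoid is a set $S=\langle a_1,\dots,a_k\rangle=\{\lambda_1a_1+\dots+\lambda_ka_k\mid \lambda_i\in\mathbb{Z}_{\ge 0}\}$ with $a_i\in\mathbb{Z}_{\geq 0}$ and $\gcd(a_1,\dots,a_k)=1$. Apéry set: for $s\in S$, $s\ne 0$, $Ap(S,s)=\{0,w_1,\dots,w_{s-1}\}$, where $w_i$ is the smallest element of $S$ congruent to $i$ modulo $s$; equivalently $Ap(S,s)=\{x\in S\mid x-s\notin S\}$. Ideal: $I_S=\langle y_1-x^{a_1},\dots,y_k-x^{a_k}\rangle\subset\mathbb{Q}[x,y_1,\dots,y_k]$. Exponents: for a monomial ordering $\prec$ and a nonzero polynomial $g=\sum a_{\underline\alpha}x^{\alpha_0}y_1^{\alpha_1}\cdots y_k^{\alpha_k}$, $\exp(g)=\max_\prec\{\underline\alpha\mid a_{\underline\alpha}\ne 0\}\in\mathbb{Z}_{\ge 0}^{k+1}$. Apéry ordering with respect to $a_j$: a monomial ordering $\prec_j$ on $\mathbb{Q}[x,y_1,\dots,y_k]$ which compares two monomials $x^{\alpha_0}y_1^{\alpha_1}\cdots y_k^{\alpha_k}$ by the following criteria, in succession (each used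 only to break ties in the previous ones; larger value means larger monomial): (1) the exponent $\alpha_0$ of $x$; (2) the weight $\sum_{i\ne j}\alpha_ia_i$; (3) an arbitrary (chosen) monomial ordering on the variables $y_i$, $i\neq j$; (4) the exponent $\alpha_j$ of $y_j$. Let $\mathcal{B}_j=\{g_1,\dots,g_r\}$ be the reduced Groebner basis of $I_S$ with respect to $\prec_j$, let $N_j$ denote the normal form with respect to $\mathcal{B}_j$ (the normal form of a monomial is again a monomial), and put $E(I_S)=\bigcup_{i=1}^r\left(\exp(g_i)+\mathbb{Z}_{\ge 0}^{k+1}\right)$, $\overline{E(I_S)}=\mathbb{Z}_{\ge 0}^{k+1}\setminus E(I_S)$. The coordinates on $\mathbb{Z}^{k+1}_{\geq 0}$ are named after the variables, so $\{x=y_j=0\}$ is the set of exponents whose $x$- and $y_j$-coordinates are zero. Define $$\Delta_{\prec_j}(S,a_j)=\left\{N\in\mathbb{Z}_{\ge 0}\mid \exp\left(N_j(x^N)\right)\in\{x=y_j=0\}\cap\overline{E(I_S)}\right\}.$$ *)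

theory Defs
  imports Complex_Main "HOL-Library.Poly_Mapping" "HOL-Number_Theory.Cong"
begin

section \<open>Numerical monoids\<close>

text \<open>The generators \<open>a\<^sub>1, \<dots>, a\<^sub>k\<close> are a family indexed by a finite type \<open>'n\<close>, so \<open>k = CARD('n)\<close>.\<close>

definition generated_monoid :: "('n::finite \<Rightarrow> nat) \<Rightarrow> nat set" where
  "generated_monoid a = {\<Sum>i\<in>UNIV. c i * a i | c :: 'n \<Rightarrow> nat. True}"

definition Apery_set :: "nat set \<Rightarrow> nat \<Rightarrow> nat set" where
  "Apery_set S s = insert 0 {LEAST w. w \<in> S \<and> [w = i] (mod s) | i. 1 \<le> i \<and> i < s}"


section \<open>Monomial orderings\<close>

text \<open>A monomial in variables from \<open>'v\<close> is given by its exponent vector. An ordering is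
  represented by its strict part. The set \<open>V\<close> is the set of variables the monomials may
  involve; nothing is said about the relation on other monomials.\<close>

type_synonym 'v expo = "'v \<Rightarrow>\<^sub>0 nat"

definition expos_in :: "'v set \<Rightarrow> 'v expo set" where
  "expos_in V = {\<alpha>. Poly_Mapping.keys \<alpha> \<subseteq> V}"

definition monomial_ordering_on :: "'v set \<Rightarrow> ('v expo \<Rightarrow> 'v expo \<Rightarrow> bool) \<Rightarrow> bool" where
  "monomial_ordering_on V lt \<longleftrightarrow>
     irreflp_on (expos_in V) lt \<and> transp_on (expos_in V) lt \<and>
     totalp_on (expos_in V) lt \<and> wfp_on (expos_in V) lt \<and>
     (\<forall>\<alpha>\<in>expos_in V. \<forall>\<beta>\<in>expos_in V. \<forall>\<gamma>\<in>expos_in V.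
        lt \<alpha> \<beta> \<longrightarrow> lt (\<alpha> + \<gamma>) (\<beta> + \<gamma>))"

abbreviation monomial_ordering :: "('v expo \<Rightarrow> 'v expo \<Rightarrow> bool) \<Rightarrow> bool" where
  "monomial_ordering \<equiv> monomial_ordering_on UNIV"

definition restrict_expo :: "'v set \<Rightarrow> 'v expo \<Rightarrow> 'v expo" where
  "restrict_expo V \<alpha> = Poly_Mapping.mapp (\<lambda>v e. if v \<in> V then e else 0) \<alpha>"


section \<open>Groebner bases and normal forms\<close>

type_synonym 'v qpoly = "'v expo \<Rightarrow>\<^sub>0 rat"

definition qvar :: "'v \<Rightarrow> 'v qpoly" where
  "qvar v = Poly_Mapping.single (Poly_Mapping.single v 1) 1"

text \<open>The ideal generated by a set is its span in the ring as a module over itself.\<close>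

definition qideal :: "'v qpoly set \<Rightarrow> 'v qpoly set" where
  "qideal = module.span (*)"

definition lead_expo :: "('v expo \<Rightarrow> 'v expo \<Rightarrow> bool) \<Rightarrow> 'v qpoly \<Rightarrow> 'v expo" where
  "lead_expo lt g = (THE \<alpha>. \<alpha> \<in> Poly_Mapping.keys g \<and>
     (\<forall>\<beta>\<in>Poly_Mapping.keys g. \<beta> \<noteq> \<alpha> \<longrightarrow> lt \<beta> \<alpha>))"

definition expo_cone :: "('v expo \<Rightarrow> 'v expo \<Rightarrow> bool) \<Rightarrow> 'v qpoly set \<Rightarrow> 'v expo set" where
  "expo_cone lt G = (\<Union>g\<in>G. {lead_expo lt g + \<gamma> | \<gamma>. True})"

definition groebner_basis ::
    "('v expo \<Rightarrow> 'v expo \<Rightarrow> bool) \<Rightarrow> 'v qpoly set \<Rightarrow> 'v qpoly set \<Rightarrow> bool" where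
  "groebner_basis lt I G \<longleftrightarrow>
     finite G \<and> G \<subseteq> I - {0} \<and> lead_expo lt ` (I - {0}) = expo_cone lt G"

definition is_reduced_groebner_basis ::
    "('v expo \<Rightarrow> 'v expo \<Rightarrow> bool) \<Rightarrow> 'v qpoly set \<Rightarrow> 'v qpoly set \<Rightarrow> bool" where
  "is_reduced_groebner_basis lt I G \<longleftrightarrow>
     groebner_basis lt I G \<and>
     (\<forall>g\<in>G. Poly_Mapping.lookup g (lead_expo lt g) = 1 \<and>
        Poly_Mapping.keys g \<inter> expo_cone lt (G - {g}) = {})"

definition reduced_groebner_basis ::
    "('v expo \<Rightarrow> 'v expo \<Rightarrow> bool) \<Rightarrow> 'v qpoly set \<Rightarrow> 'v qpoly set" where
  "reduced_groebner_basis lt I = (THE G. is_reduced_groebner_basis lt I G)"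

text \<open>One step of the division of \<open>f\<close> by \<open>G\<close>: some term of \<open>f\<close>, not necessarily the leading
  one, is cancelled by a multiple of an element of \<open>G\<close>.\<close>

definition reduction_step ::
    "('v expo \<Rightarrow> 'v expo \<Rightarrow> bool) \<Rightarrow> 'v qpoly set \<Rightarrow> 'v qpoly \<Rightarrow> 'v qpoly \<Rightarrow> bool" where
  "reduction_step lt G f h \<longleftrightarrow>
     (\<exists>g\<in>G. \<exists>\<gamma>. lead_expo lt g + \<gamma> \<in> Poly_Mapping.keys f \<and>
        h = f - Poly_Mapping.single \<gamma>
                  (Poly_Mapping.lookup f (lead_expo lt g + \<gamma>) /
                   Poly_Mapping.lookup g (lead_expo lt g)) * g)"

definition normal_form ::
    "('v expo \<Rightarrow> 'v expo \<Rightarrow> bool) \<Rightarrow> 'v qpoly set \<Rightarrow> 'v qpoly \<Rightarrow> 'v qpoly" where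
  "normal_form lt G f =
     (THE h. (reduction_step lt G)\<^sup>*\<^sup>* f h \<and> (\<nexists>h'. reduction_step lt G h h'))"


section \<open>The ideal of a numerical monoid and Apery orderings\<close>

text \<open>The variables of \<open>\<rat>[x, y\<^sub>1, \<dots>, y\<^sub>k]\<close> are the elements of \<open>'n option\<close>: \<open>None\<close> is \<open>x\<close> and
  \<open>Some i\<close> is \<open>y\<^sub>i\<close>.\<close>

definition monoid_ideal :: "('n::finite \<Rightarrow> nat) \<Rightarrow> 'n option qpoly set" where
  "monoid_ideal a = qideal (range (\<lambda>i. qvar (Some i) - qvar None ^ a i))"

definition weight_except :: "('n::finite \<Rightarrow> nat) \<Rightarrow> 'n \<Rightarrow> 'n option expo \<Rightarrow> nat" where
  "weight_except a j \<alpha> = (\<Sum>i\<in>UNIV - {j}. Poly_Mapping.lookup \<alpha> (Some i) * a i)"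

definition Apery_ordering ::
    "('n::finite \<Rightarrow> nat) \<Rightarrow> 'n \<Rightarrow> ('n option expo \<Rightarrow> 'n option expo \<Rightarrow> bool) \<Rightarrow> bool" where
  "Apery_ordering a j lt \<longleftrightarrow>
     monomial_ordering lt \<and>
     (\<exists>lt'. monomial_ordering_on (Some ` (UNIV - {j})) lt' \<and>
       (\<forall>\<alpha> \<beta>. lt \<alpha> \<beta> \<longleftrightarrow>
          (let \<alpha>' = restrict_expo (Some ` (UNIV - {j})) \<alpha>;
               \<beta>' = restrict_expo (Some ` (UNIV - {j})) \<beta>
           in Poly_Mapping.lookup \<alpha> None < Poly_Mapping.lookup \<beta> None \<or>
              Poly_Mapping.lookup \<alpha> None = Poly_Mapping.lookup \<beta> None \<and>
                (weight_except a j \<alpha> < weight_except a j \<beta> \<or>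
                 weight_except a j \<alpha> = weight_except a j \<beta> \<and>
                   (lt' \<alpha>' \<beta>' \<or>
                    \<alpha>' = \<beta>' \<and>
                      Poly_Mapping.lookup \<alpha> (Some j) < Poly_Mapping.lookup \<beta> (Some j))))))"

definition Apery_Delta ::
    "('n option expo \<Rightarrow> 'n option expo \<Rightarrow> bool) \<Rightarrow> ('n::finite \<Rightarrow> nat) \<Rightarrow> 'n \<Rightarrow> nat set" where
  "Apery_Delta lt a j =
     (let B = reduced_groebner_basis lt (monoid_ideal a)
      in {N. lead_expo lt (normal_form lt B (qvar None ^ N)) \<in>
            {\<alpha>. Poly_Mapping.lookup \<alpha> None = 0 \<and> Poly_Mapping.lookup \<alpha> (Some j) = 0}
              \<inter> - expo_cone lt B})"

end

theory Submission
  imports Defs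
begin

text \<open>Grade \<open>\<rat>[x, y\<^sub>1, \<dots>, y\<^sub>k]\<close> by giving \<open>x\<close> weight 1 and \<open>y\<^sub>i\<close> weight \<open>a\<^sub>i\<close>. Then \<open>I\<^sub>S\<close> is the
  kernel of the map that sends every monomial to its weight, so a monomial is the leading one of an
  element of \<open>I\<^sub>S\<close> iff it is not the least monomial of its weight, and the normal form of \<open>x\<^sup>N\<close> is the
  least monomial of weight \<open>N\<close>. For an Apery ordering this monomial avoids \<open>x\<close> iff \<open>N \<in> S\<close>, and
  it then avoids \<open>y\<^sub>j\<close> iff \<open>N - a\<^sub>j \<notin> S\<close>, because a larger exponent of \<open>y\<^sub>j\<close> lowers the weight
  of the remaining variables.\<close>

section \<open>Apery sets\<close>

lemma bezout_finite:
  fixes a :: "'i \<Rightarrow> nat"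
  assumes "finite A"
  shows "\<exists>c :: 'i \<Rightarrow> int. (\<Sum>i\<in>A. c i * int (a i)) = int (Gcd (a ` A))"
  using assms
proof (induction A)
  case (insert i A)
  then obtain c :: "'i \<Rightarrow> int" where c: "(\<Sum>i\<in>A. c i * int (a i)) = int (Gcd (a ` A))"
    by blast
  obtain u v :: int where uv: "u * int (a i) + v * int (Gcd (a ` A)) = gcd (int (a i)) (int (Gcd (a ` A)))"
    using bezout_int by blast
  define d where "d = (\<lambda>l. if l = i then u else v * c l)"
  have "(\<Sum>l\<in>A. d l * int (a l)) = (\<Sum>l\<in>A. v * (c l * int (a l)))"
    using insert.hyps by (intro sum.cong) (auto simp: d_def)
  also have "\<dots> = v * int (Gcd (a ` A))"
    by (simp add: c flip: sum_distrib_left)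
  finally have "(\<Sum>l\<in>insert i A. d l * int (a l)) = u * int (a i) + v * int (Gcd (a ` A))"
    using insert.hyps by (simp add: d_def)
  also have "\<dots> = int (Gcd (a ` insert i A))"
    using uv by simp
  finally show ?case by blast
qed simp

lemma generated_monoid_zero: "0 \<in> generated_monoid a"
  unfolding generated_monoid_def by (rule CollectI, rule exI[of _ "\<lambda>_. 0"]) simp

lemma generated_monoid_generator: "a j \<in> generated_monoid a"
  unfolding generated_monoid_def
  by (rule CollectI, rule exI[of _ "\<lambda>i. if i = j then 1 else 0"]) (simp add: if_distrib[of "\<lambda>x. x * _"] cong: if_cong)

lemma generated_monoid_add:
  assumes "m \<in> generated_monoid a" "n \<in> generated_monoid a"
  shows "m + n \<in> generated_monoid a"
proof -
  obtain c d where "m = (\<Sum>i\<in>UNIV. c i * a i)" "n = (\<Sum>i\<in>UNIV. d i * a i)"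
    using assms unfolding generated_monoid_def by blast
  then have "m + n = (\<Sum>i\<in>UNIV. (c i + d i) * a i)"
    by (simp add: sum.distrib distrib_right)
  then show ?thesis unfolding generated_monoid_def by (intro CollectI exI[of _ "\<lambda>i. c i + d i"]) simp
qed

text \<open>Bezout coefficients of the generators may be negative. Scaling them by \<open>r\<close>
  and then reducing modulo \<open>s\<close> makes them nonnegative without changing the class of the
  sum.\<close>

lemma generated_monoid_cong:
  fixes a :: "'n::finite \<Rightarrow> nat"
  assumes "Gcd (range a) = 1" "s > 0"
  shows "\<exists>n\<in>generated_monoid a. [n = r] (mod s)"
proof -
  obtain c :: "'n \<Rightarrow> int" where c: "(\<Sum>i\<in>UNIV. c i * int (a i)) = 1"
    using bezout_finite[of "UNIV :: 'n set" a] assms(1) by auto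
  define d where "d = (\<lambda>i. nat ((int r * c i) mod int s))"
  have d: "int (d i) = (int r * c i) mod int s" for i
    using assms(2) by (simp add: d_def)
  have "[(\<Sum>i\<in>UNIV. int (d i) * int (a i)) = (\<Sum>i\<in>UNIV. (int r * c i) * int (a i))] (mod int s)"
    by (intro cong_sum cong_mult cong_refl) (simp add: d)
  also have "(\<Sum>i\<in>UNIV. (int r * c i) * int (a i)) = int r"
    using c by (simp add: mult.assoc flip: sum_distrib_left)
  finally have "[int (\<Sum>i\<in>UNIV. d i * a i) = int r] (mod int s)"
    by simp
  then have "[(\<Sum>i\<in>UNIV. d i * a i) = r] (mod s)"
    by (simp add: cong_int_iff del: of_nat_sum)
  then show ?thesis unfolding generated_monoid_def by blast
qed

text \<open>Since \<open>S\<close> is closed under adding \<open>s\<close>, its least element in a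
  residue class is the only one there from which \<open>s\<close> cannot be subtracted within
  \<open>S\<close>. The assumption \<open>residues\<close> makes each of these minima exist.\<close>

lemma Apery_set_eq:
  assumes zero: "0 \<in> S" and add: "\<And>m n. m \<in> S \<Longrightarrow> n \<in> S \<Longrightarrow> m + n \<in> S"
    and s: "s \<in> S" "s > 0" and residues: "\<And>r. \<exists>n\<in>S. [n = r] (mod s)"
  shows "Apery_set S s = {n \<in> S. \<nexists>m. m \<in> S \<and> n = m + s}"
proof -
  have mult: "n + q * s \<in> S" if "n \<in> S" for n q
    by (induction q) (use that add s in \<open>auto simp: algebra_simps\<close>, metis add add.assoc add.commute s(1))
  \<comment> \<open>Descending from \<open>n\<close> to \<open>m\<close> in steps of
    \<open>s\<close> stays in \<open>S\<close>, so already the first step down does.\<close>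
  have congD: "n = m \<or> (\<exists>k\<in>S. n = k + s)" if mn: "m \<in> S" "m \<le> n" "[m = n] (mod s)" for m n
  proof -
    obtain q where q: "n = m + q * s"
      using mn by (metis cong_le_nat cong_sym add.commute)
    show ?thesis
    proof (cases q)
      case (Suc p)
      then have "n = (m + p * s) + s" using q by simp
      then show ?thesis using mult[OF mn(1)] by blast
    qed (use q in simp)
  qed
  show ?thesis
  proof (intro equalityI subsetI)
    fix n assume "n \<in> Apery_set S s"
    then consider "n = 0"
      | i where "1 \<le> i" "i < s" "n = (LEAST w. w \<in> S \<and> [w = i] (mod s))"
      unfolding Apery_set_def by blast
    then show "n \<in> {n \<in> S. \<nexists>m. m \<in> S \<and> n = m + s}"
    proof cases
      case 1
      then show ?thesis using zero s by simp
    next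
      case 2
      have n: "n \<in> S \<and> [n = i] (mod s)"
        unfolding 2(3) using LeastI_ex[of "\<lambda>w. w \<in> S \<and> [w = i] (mod s)"] residues[of i] by blast
      have "False" if "m \<in> S" "n = m + s" for m
      proof -
        have "[m = i] (mod s)" using n that by (simp add: cong_def)
        then have "n \<le> m" unfolding 2(3) using that by (intro Least_le) simp
        then show False using that s by simp
      qed
      then show ?thesis using n by blast
    qed
  next
    fix n assume n: "n \<in> {n \<in> S. \<nexists>m. m \<in> S \<and> n = m + s}"
    show "n \<in> Apery_set S s"
    proof (cases "n mod s = 0")
      case True
      then have "n = 0" using congD[OF zero, of n] n by (auto simp: cong_def)
      then show ?thesis by (simp add: Apery_set_def)
    next
      case False
      define w where "w = (LEAST w. w \<in> S \<and> [w = n mod s] (mod s))"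
      have ex: "n \<in> S \<and> [n = n mod s] (mod s)"
        using n by (simp add: cong_def)
      have "w \<in> S \<and> [w = n mod s] (mod s)"
        unfolding w_def using ex by (rule LeastI)
      moreover have "w \<le> n"
        unfolding w_def using ex by (rule Least_le)
      ultimately have "n = w"
        using congD[of w n] n by (auto simp: cong_def)
      moreover have "1 \<le> n mod s" "n mod s < s"
        using False s by auto
      ultimately show ?thesis unfolding Apery_set_def w_def by blast
    qed
  qed
qed

section \<open>Dickson's lemma\<close>

text \<open>Every sequence has a monotone subsequence, and a decreasing one in the naturals is
  constant from the point where it attains its minimum.\<close>

lemma nat_incseq_subseq:
  fixes f :: "nat \<Rightarrow> nat"
  shows "\<exists>r. strict_mono r \<and> incseq (\<lambda>n. f (r n))"
proof -
  obtain r where r: "strict_mono r" "monoseq (\<lambda>n. f (r n))"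
    using seq_monosub by blast
  show ?thesis
  proof (cases "incseq (\<lambda>n. f (r n))")
    case False
    then have dec: "decseq (\<lambda>n. f (r n))"
      using r(2) by (auto simp: monoseq_iff)
    obtain k where k: "\<And>n. f (r k) \<le> f (r n)"
      using ex_has_least_nat[of "\<lambda>_. True" _ "\<lambda>n. f (r n)"] by auto
    have "f (r (k + n)) = f (r k)" for n
      using k[of "k + n"] decseqD[OF dec, of k "k + n"] by simp
    then have "incseq (\<lambda>n. f (r (k + n)))"
      by (simp add: incseq_def)
    moreover have "strict_mono (\<lambda>n. r (k + n))"
      using r(1) by (simp add: strict_mono_def)
    ultimately show ?thesis by blast
  qed (use r in blast)
qed

text \<open>Coordinates are treated one at a time: passing to a further subsequence keeps the
  earlier ones increasing.\<close>

lemma incseq_subseq_finite: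
  fixes f :: "nat \<Rightarrow> 'v \<Rightarrow> nat"
  assumes "finite V"
  shows "\<exists>r. strict_mono r \<and> (\<forall>v\<in>V. incseq (\<lambda>n. f (r n) v))"
  using assms
proof (induction V)
  case empty
  show ?case using strict_mono_id by auto
next
  case (insert v V)
  then obtain r where r: "strict_mono r" "\<forall>v\<in>V. incseq (\<lambda>n. f (r n) v)"
    by blast
  obtain q where q: "strict_mono q" "incseq (\<lambda>n. f (r (q n)) v)"
    using nat_incseq_subseq[of "\<lambda>n. f (r n) v"] by blast
  have "incseq (\<lambda>n. f (r (q n)) u)" if "u \<in> V" for u
    using r(2) that q(1) by (simp add: incseq_def strict_mono_less_eq)
  moreover have "strict_mono (\<lambda>n. r (q n))"
    using r(1) q(1) by (simp add: strict_mono_def)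
  ultimately show ?case using q(2) by blast
qed

text \<open>\<open>M\<close> is an antichain for divisibility of monomials. If it were infinite, an
  injective sequence in it would have a subsequence increasing in every coordinate, and there the
  first term divides the second.\<close>

lemma Dickson:
  fixes M :: "'v::finite expo set"
  assumes antichain: "\<And>\<beta> \<gamma>. \<beta> \<in> M \<Longrightarrow> \<beta> + \<gamma> \<in> M \<Longrightarrow> \<gamma> = 0"
  shows "finite M"
proof (rule ccontr)
  assume "infinite M"
  then obtain f :: "nat \<Rightarrow> 'v expo" where f: "inj f" "range f \<subseteq> M"
    using infinite_countable_subset by blast
  obtain r where r: "strict_mono r" "\<And>v. incseq (\<lambda>n. Poly_Mapping.lookup (f (r n)) v)"
    using incseq_subseq_finite[of "UNIV :: 'v set" "\<lambda>n. Poly_Mapping.lookup (f n)"] by auto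
  \<comment> \<open>Subtraction of exponents is truncated. It is exact here because no coordinate
    drops from \<open>f (r 0)\<close> to \<open>f (r 1)\<close>.\<close>
  have "f (r 1) = f (r 0) + (f (r 1) - f (r 0))"
    using incseqD[OF r(2), of 0 1] by (intro poly_mapping_eqI) (simp add: lookup_add lookup_minus)
  moreover from this have "f (r 1) - f (r 0) = 0"
    using antichain f(2) by (metis rangeI subsetD)
  ultimately have "r 1 = r 0"
    using f(1) by (simp add: inj_def)
  then show False
    using strict_monoD[OF r(1), of 0 1] by simp
qed

section \<open>Polynomials graded by a weight\<close>

text \<open>A step by addition suits additive maps on polynomials, and also exponent vectors, which
  are built up by multiplying monomials.\<close>

lemma poly_mapping_single_add_induct [case_names zero single_add]:
  assumes "P 0" and step: "\<And>f k v. P f \<Longrightarrow> P (f + Poly_Mapping.single k v)"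
  shows "P (f :: 'a \<Rightarrow>\<^sub>0 'b::comm_monoid_add)"
proof (induction f rule: Poly_Mapping.update_induct)
  case (update f k v)
  have "Poly_Mapping.update k v f = f + Poly_Mapping.single k v"
    using update(1) by (intro poly_mapping_eqI)
      (auto simp: lookup_update lookup_add lookup_single in_keys_iff when_def)
  then show ?case using step update by simp
qed (rule assms(1))

text \<open>The additive map between monoid algebras induced by \<open>w\<close>. For the weight it
  is the substitution of t for \<open>x\<close> and of t^(a_i) for \<open>y_i\<close>.\<close>

definition push :: "('a \<Rightarrow> 'b) \<Rightarrow> ('a \<Rightarrow>\<^sub>0 'c) \<Rightarrow> ('b \<Rightarrow>\<^sub>0 'c::comm_monoid_add)" where
  "push w f = (\<Sum>\<alpha>\<in>Poly_Mapping.keys f. Poly_Mapping.single (w \<alpha>) (Poly_Mapping.lookup f \<alpha>))"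

lemma push_zero [simp]: "push w 0 = 0"
  by (simp add: push_def)

lemma push_single [simp]: "push w (Poly_Mapping.single \<alpha> c) = Poly_Mapping.single (w \<alpha>) c"
  by (simp add: push_def)

lemma push_add: "push w (f + g) = push w f + push w g"
  unfolding push_def by (rule setsum_keys_plus_distrib) (simp_all add: single_add)

lemma push_diff:
  fixes f g :: "'a \<Rightarrow>\<^sub>0 'c::ab_group_add"
  shows "push w (f - g) = push w f - push w g"
  using push_add[of w "f - g" g] by simp

text \<open>Additivity in both factors reduces the claim to products of single terms, where it is
  the additivity of \<open>w\<close>.\<close>

lemma push_mult:
  fixes f g :: "'a::comm_monoid_add \<Rightarrow>\<^sub>0 'c::comm_semiring_0"
  assumes w: "\<And>\<alpha> \<beta>. w (\<alpha> + \<beta>) = (w \<alpha> + w \<beta> :: 'b::comm_monoid_add)"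
  shows "push w (f * g) = push w f * push w g"
proof (induction f rule: poly_mapping_single_add_induct)
  case (single_add f k v)
  have "push w (Poly_Mapping.single k v * g) = Poly_Mapping.single (w k) v * push w g"
    by (induction g rule: poly_mapping_single_add_induct)
      (simp_all add: push_add distrib_left mult_single w)
  then show ?case
    by (simp add: push_add distrib_right single_add.IH)
qed simp

text \<open>Terms with distinct images cannot merge, so no coefficient is lost.\<close>

lemma lookup_push_inj_on:
  assumes "inj_on w (Poly_Mapping.keys f)" "\<alpha> \<in> Poly_Mapping.keys f"
  shows "Poly_Mapping.lookup (push w f) (w \<alpha>) = Poly_Mapping.lookup f \<alpha>"
proof -
  have "Poly_Mapping.lookup (push w f) (w \<alpha>) =
      (\<Sum>\<beta>\<in>Poly_Mapping.keys f. if \<beta> = \<alpha> then Poly_Mapping.lookup f \<beta> else 0)"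
    unfolding push_def lookup_sum
    using assms by (intro sum.cong) (auto simp: lookup_single when_def inj_on_def)
  then show ?thesis using assms(2) by simp
qed

abbreviation monomial :: "'v expo \<Rightarrow> 'v qpoly" where
  "monomial \<alpha> \<equiv> Poly_Mapping.single \<alpha> 1"

lemma monomial_add: "monomial (\<alpha> + \<beta>) = monomial \<alpha> * monomial \<beta>"
  by (simp add: mult_single)

lemma qvar_power: "qvar v ^ n = monomial (Poly_Mapping.single v n)"
proof (induction n)
  case 0
  then show ?case by simp
next
  case (Suc n)
  then show ?case
    by (simp add: qvar_def mult_single flip: single_add)
qed

interpretation qmod: module "(*) :: 'v qpoly \<Rightarrow> 'v qpoly \<Rightarrow> 'v qpoly"
  by unfold_locales (simp_all add: algebra_simps)

section \<open>The weight of a monomial and the ideal as the kernel of the weight map\<close>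

definition weight :: "('n::finite \<Rightarrow> nat) \<Rightarrow> 'n option expo \<Rightarrow> nat" where
  "weight a \<alpha> = Poly_Mapping.lookup \<alpha> None + (\<Sum>i\<in>UNIV. Poly_Mapping.lookup \<alpha> (Some i) * a i)"

lemma weight_zero [simp]: "weight a 0 = 0"
  by (simp add: weight_def)

lemma weight_add [simp]: "weight a (\<alpha> + \<beta>) = weight a \<alpha> + weight a \<beta>"
  by (simp add: weight_def lookup_add sum.distrib distrib_right)

lemma weight_single_None [simp]: "weight a (Poly_Mapping.single None n) = n"
  by (simp add: weight_def lookup_single)

lemma weight_single_Some [simp]: "weight a (Poly_Mapping.single (Some i) n) = n * a i"
  by (simp add: weight_def lookup_single when_def if_distrib[of "\<lambda>x. x * _"] cong: if_cong)

lemma weight_eq_weight_except: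
  "weight a \<alpha> = Poly_Mapping.lookup \<alpha> None + Poly_Mapping.lookup \<alpha> (Some j) * a j + weight_except a j \<alpha>"
  unfolding weight_def weight_except_def by (subst sum.remove[of UNIV j]) auto

text \<open>The two terms of a generator have the same weight and opposite coefficients, so they
  cancel. Multiplicativity of \<open>push\<close> carries this to multiples.\<close>

lemma push_weight_ideal:
  assumes "f \<in> monoid_ideal a"
  shows "push (weight a) f = 0"
  using assms unfolding monoid_ideal_def qideal_def
proof (induction f rule: qmod.span_induct_alt)
  case (step c x y)
  have "push (weight a) x = 0"
    using step.hyps(1) by (auto simp: push_diff qvar_power) (simp add: qvar_def)
  then show ?case
    using step by (simp add: push_add push_mult)
qed simp

lemma ideal_mult: "f \<in> monoid_ideal a \<Longrightarrow> p * f \<in> monoid_ideal a"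
  unfolding monoid_ideal_def qideal_def by (rule qmod.span_scale)

lemma ideal_add: "f \<in> monoid_ideal a \<Longrightarrow> g \<in> monoid_ideal a \<Longrightarrow> f + g \<in> monoid_ideal a"
  unfolding monoid_ideal_def qideal_def by (rule qmod.span_add)

lemma ideal_diff: "f \<in> monoid_ideal a \<Longrightarrow> g \<in> monoid_ideal a \<Longrightarrow> f - g \<in> monoid_ideal a"
  unfolding monoid_ideal_def qideal_def by (rule qmod.span_diff)

lemma ideal_zero: "0 \<in> monoid_ideal a"
  unfolding monoid_ideal_def qideal_def by (rule qmod.span_zero)

text \<open>Modulo the ideal each \<open>y_i\<close> may be replaced by a power of \<open>x\<close>.
  This passes from the variables to their powers and then to all products.\<close>

lemma monomial_minus_pure_power_in_ideal:
  "monomial \<alpha> - monomial (Poly_Mapping.single None (weight a \<alpha>)) \<in> monoid_ideal a"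
    (is "?D \<alpha> \<in> _")
proof -
  have add: "?D (\<alpha> + \<beta>) \<in> monoid_ideal a"
    if "?D \<alpha> \<in> monoid_ideal a" "?D \<beta> \<in> monoid_ideal a" for \<alpha> \<beta>
  proof -
    \<comment> \<open>Telescoping: first the factor \<beta> is replaced by its power of
      \<open>x\<close>, then the factor \<alpha>.\<close>
    have "?D (\<alpha> + \<beta>) = monomial \<alpha> * ?D \<beta> + monomial (Poly_Mapping.single None (weight a \<beta>)) * ?D \<alpha>"
      by (simp add: monomial_add single_add algebra_simps)
    then show ?thesis using that ideal_add ideal_mult by metis
  qed
  have var: "?D (Poly_Mapping.single (Some i) 1) \<in> monoid_ideal a" for i
  proof -
    have "qvar (Some i) - qvar None ^ a i \<in> monoid_ideal a"
      unfolding monoid_ideal_def qideal_def by (rule qmod.span_base) simp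
    then show ?thesis unfolding qvar_power by (simp add: qvar_def)
  qed
  have single: "?D (Poly_Mapping.single v n) \<in> monoid_ideal a" for v n
  proof (cases v)
    case None
    then show ?thesis by (simp add: ideal_zero)
  next
    case (Some i)
    show ?thesis
    proof (induction n)
      case 0
      then show ?case by (simp add: ideal_zero)
    next
      case (Suc n)
      have "Poly_Mapping.single v (Suc n) = Poly_Mapping.single v n + Poly_Mapping.single (Some i) 1"
        using Some by (simp flip: single_add)
      then show ?case using add[OF Suc.IH var] by metis
    qed
  qed
  show ?thesis
  proof (induction \<alpha> rule: poly_mapping_single_add_induct)
    case zero
    then show ?case by (simp add: ideal_zero)
  next
    case (single_add \<alpha> k v)
    then show ?case using add single by blast
  qed
qed

lemma monomial_diff_in_ideal:
  assumes "weight a \<alpha> = weight a \<beta>"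
  shows "monomial \<alpha> - monomial \<beta> \<in> monoid_ideal a"
  using ideal_diff[OF monomial_minus_pure_power_in_ideal[of \<alpha> a] monomial_minus_pure_power_in_ideal[of \<beta> a]] assms
  by simp

section \<open>Leading exponents and normal forms\<close>

lemma expo_cone_iff: "\<alpha> \<in> expo_cone lt G \<longleftrightarrow> (\<exists>g\<in>G. \<exists>\<gamma>. \<alpha> = lead_expo lt g + \<gamma>)"
  by (auto simp: expo_cone_def)

locale monoid_ordering =
  fixes lt :: "'n::finite option expo \<Rightarrow> 'n option expo \<Rightarrow> bool" and a :: "'n \<Rightarrow> nat"
  assumes ordering: "monomial_ordering lt"
begin

abbreviation "I \<equiv> monoid_ideal a"

lemma lt_irrefl: "\<not> lt \<alpha> \<alpha>"
  using ordering by (simp add: monomial_ordering_on_def expos_in_def irreflp_on_def)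

lemma lt_trans: "lt \<alpha> \<beta> \<Longrightarrow> lt \<beta> \<gamma> \<Longrightarrow> lt \<alpha> \<gamma>"
  using ordering by (auto simp: monomial_ordering_on_def expos_in_def dest: transpD)

lemma lt_total: "\<alpha> \<noteq> \<beta> \<Longrightarrow> lt \<alpha> \<beta> \<or> lt \<beta> \<alpha>"
  using ordering by (simp add: monomial_ordering_on_def expos_in_def totalp_on_def)

lemma lt_wf: "wfp lt"
  using ordering by (simp add: monomial_ordering_on_def expos_in_def)

lemma lt_add: "lt \<alpha> \<beta> \<Longrightarrow> lt (\<alpha> + \<gamma>) (\<beta> + \<gamma>)"
  using ordering by (simp add: monomial_ordering_on_def expos_in_def)

text \<open>A least \<open>\<gamma>\<close> with \<open>\<gamma> < 0\<close> would satisfy \<open>\<gamma> + \<gamma> < \<gamma> < 0\<close>.\<close>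

lemma lt_zero: "\<not> lt \<gamma> 0"
proof (induction \<gamma> rule: wfp_induct_rule[OF lt_wf])
  case (1 \<gamma>)
  show ?case
  proof
    assume "lt \<gamma> 0"
    then have "lt (\<gamma> + \<gamma>) \<gamma>"
      using lt_add[of \<gamma> 0 \<gamma>] by simp
    then show False
      using 1 lt_trans \<open>lt \<gamma> 0\<close> by blast
  qed
qed

text \<open>By totality and \<open>lt_zero\<close> every nonzero \<gamma> lies above 0; translating
  by \<alpha> puts a proper divisor below its multiple.\<close>

lemma lt_add_right: "\<gamma> \<noteq> 0 \<Longrightarrow> lt \<alpha> (\<alpha> + \<gamma>)"
  using lt_total[of 0 \<gamma>] lt_zero[of \<gamma>] lt_add[of 0 \<gamma> \<alpha>] by (auto simp: add.commute[of \<gamma>])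

lemma finite_has_greatest:
  assumes "finite A" "A \<noteq> {}"
  shows "\<exists>\<alpha>\<in>A. \<forall>\<beta>\<in>A. \<beta> \<noteq> \<alpha> \<longrightarrow> lt \<beta> \<alpha>"
  using assms
proof (induction A rule: finite_ne_induct)
  case (insert \<alpha> A)
  then obtain \<mu> where \<mu>: "\<mu> \<in> A" "\<And>\<beta>. \<beta> \<in> A \<Longrightarrow> \<beta> \<noteq> \<mu> \<Longrightarrow> lt \<beta> \<mu>"
    by blast
  show ?case
  proof (cases "lt \<mu> \<alpha>")
    case True
    then show ?thesis using \<mu> lt_trans by (intro bexI[of _ \<alpha>]) blast+
  next
    case False
    then show ?thesis using \<mu> lt_total by (intro bexI[of _ \<mu>]) blast+
  qed
qed simp

lemma lead_expo_eqI:
  assumes "\<alpha> \<in> Poly_Mapping.keys f" "\<And>\<beta>. \<beta> \<in> Poly_Mapping.keys f \<Longrightarrow> \<beta> \<noteq> \<alpha> \<Longrightarrow> lt \<beta> \<alpha>"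
  shows "lead_expo lt f = \<alpha>"
  unfolding lead_expo_def
proof (rule the_equality)
  fix \<gamma> assume \<gamma>: "\<gamma> \<in> Poly_Mapping.keys f \<and> (\<forall>\<beta>\<in>Poly_Mapping.keys f. \<beta> \<noteq> \<gamma> \<longrightarrow> lt \<beta> \<gamma>)"
  show "\<gamma> = \<alpha>"
  proof (rule ccontr)
    assume "\<gamma> \<noteq> \<alpha>"
    then have "lt \<gamma> \<alpha>" "lt \<alpha> \<gamma>"
      using \<gamma> assms by auto
    then show False
      using lt_trans lt_irrefl by blast
  qed
qed (use assms in blast)

lemma lead_expo:
  assumes "f \<noteq> 0"
  shows "lead_expo lt f \<in> Poly_Mapping.keys f"
    and "\<beta> \<in> Poly_Mapping.keys f \<Longrightarrow> \<beta> \<noteq> lead_expo lt f \<Longrightarrow> lt \<beta> (lead_expo lt f)"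
proof -
  obtain \<alpha> where "\<alpha> \<in> Poly_Mapping.keys f" "\<forall>\<beta>\<in>Poly_Mapping.keys f. \<beta> \<noteq> \<alpha> \<longrightarrow> lt \<beta> \<alpha>"
    using finite_has_greatest[of "Poly_Mapping.keys f"] assms by auto
  moreover from this have "lead_expo lt f = \<alpha>"
    by (intro lead_expo_eqI) auto
  ultimately show "lead_expo lt f \<in> Poly_Mapping.keys f"
    and "\<beta> \<in> Poly_Mapping.keys f \<Longrightarrow> \<beta> \<noteq> lead_expo lt f \<Longrightarrow> lt \<beta> (lead_expo lt f)"
    by auto
qed

section \<open>Least monomials of given weight and the leading exponents of the ideal\<close>

definition least_expo :: "nat \<Rightarrow> 'n option expo" where
  "least_expo n = (SOME \<alpha>. weight a \<alpha> = n \<and> (\<forall>\<beta>. weight a \<beta> = n \<longrightarrow> \<not> lt \<beta> \<alpha>))"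

lemma weight_least_expo [simp]: "weight a (least_expo n) = n"
  and least_expo_least: "weight a \<beta> = n \<Longrightarrow> \<not> lt \<beta> (least_expo n)"
proof -
  have "\<exists>\<alpha>. weight a \<alpha> = n \<and> (\<forall>\<beta>. weight a \<beta> = n \<longrightarrow> \<not> lt \<beta> \<alpha>)"
  proof -
    \<comment> \<open>The pure power of \<open>x\<close> shows that weight \<open>n\<close> occurs,
      so well-foundedness yields a minimal monomial.\<close>
    obtain \<alpha> where "\<alpha> \<in> {\<alpha>. weight a \<alpha> = n}" "\<And>\<beta>. lt \<beta> \<alpha> \<Longrightarrow> \<beta> \<notin> {\<alpha>. weight a \<alpha> = n}"
      using wfE_min[of "{(\<alpha>, \<beta>). lt \<alpha> \<beta>}" "Poly_Mapping.single None n" "{\<alpha>. weight a \<alpha> = n}"] lt_wf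
      unfolding wfp_def by auto
    then show ?thesis by blast
  qed
  from someI_ex[OF this] show "weight a (least_expo n) = n"
    "weight a \<beta> = n \<Longrightarrow> \<not> lt \<beta> (least_expo n)"
    unfolding least_expo_def by blast+
qed

lemma least_expo_eqI: "weight a \<alpha> = n \<Longrightarrow> \<not> lt (least_expo n) \<alpha> \<Longrightarrow> \<alpha> = least_expo n"
  using lt_total least_expo_least by blast

text \<open>A description of the leading exponents of the ideal that mentions no basis;
  \<open>lead_ideal\<close> confirms that it is the right set.\<close>

definition E :: "'n option expo set" where
  "E = {\<alpha>. \<alpha> \<noteq> least_expo (weight a \<alpha>)}"

lemma E_iff: "\<alpha> \<in> E \<longleftrightarrow> lt (least_expo (weight a \<alpha>)) \<alpha>"
  using least_expo_eqI[of \<alpha>] lt_irrefl by (auto simp: E_def)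

lemma E_I: "weight a \<alpha> = weight a \<beta> \<Longrightarrow> lt \<beta> \<alpha> \<Longrightarrow> \<alpha> \<in> E"
  using least_expo_least E_def by fastforce

text \<open>Translating the least monomial of the weight of \<alpha> by \<gamma> gives a monomial
  that is below \<alpha> + \<gamma> and has the same weight.\<close>

lemma E_add:
  assumes "\<alpha> \<in> E"
  shows "\<alpha> + \<gamma> \<in> E"
  using E_I[OF _ lt_add[of "least_expo (weight a \<alpha>)" \<alpha> \<gamma>]] assms by (simp add: E_iff)

text \<open>For \<alpha> in \<open>E\<close>, the tail will turn out to be the normal form of the
  leading monomial; for other \<alpha> the difference is 0.\<close>

definition binom :: "'n option expo \<Rightarrow> 'n option qpoly" where
  "binom \<alpha> = monomial \<alpha> - monomial (least_expo (weight a \<alpha>))"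

lemma binom_in_ideal: "binom \<alpha> \<in> I"
  unfolding binom_def by (rule monomial_diff_in_ideal) simp

lemma keys_binom:
  assumes "\<alpha> \<in> E"
  shows "Poly_Mapping.keys (binom \<alpha>) = {\<alpha>, least_expo (weight a \<alpha>)}"
  using assms unfolding binom_def E_def
  by (auto simp: in_keys_iff lookup_minus lookup_single when_def split: if_splits)

lemma lookup_binom: "\<alpha> \<in> E \<Longrightarrow> Poly_Mapping.lookup (binom \<alpha>) \<alpha> = 1"
  by (simp add: binom_def E_def lookup_minus lookup_single when_def)

lemma binom_nonzero: "\<alpha> \<in> E \<Longrightarrow> binom \<alpha> \<noteq> 0"
  using lookup_binom[of \<alpha>] by auto

lemma lead_binom: "\<alpha> \<in> E \<Longrightarrow> lead_expo lt (binom \<alpha>) = \<alpha>"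
  by (rule lead_expo_eqI) (auto simp: keys_binom E_iff)

lemma keys_subset_E_compl_imp_inj_on: "Poly_Mapping.keys f \<subseteq> - E \<Longrightarrow> inj_on (weight a) (Poly_Mapping.keys f)"
  by (rule inj_onI) (auto simp: E_def, metis (mono_tags, lifting) Compl_iff mem_Collect_eq subsetD)

text \<open>Outside \<open>E\<close> there is one monomial per weight, so \<open>push\<close> keeps
  every coefficient of \<open>f\<close>; yet it sends \<open>f\<close> to 0.\<close>

lemma standard_in_ideal_eq_zero:
  assumes "f \<in> I" "Poly_Mapping.keys f \<subseteq> - E"
  shows "f = 0"
proof -
  have "\<alpha> \<notin> Poly_Mapping.keys f" for \<alpha>
    using lookup_push_inj_on[OF keys_subset_E_compl_imp_inj_on[OF assms(2)], of \<alpha>]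
    by (auto simp: push_weight_ideal[OF assms(1)] in_keys_iff)
  then show ?thesis
    by (intro poly_mapping_eqI) (simp add: in_keys_iff)
qed

text \<open>If the leading monomial were the least of its weight, all other terms, being smaller,
  would have other weights. The leading coefficient would then survive in
  \<open>push\<close>.\<close>

lemma lead_in_E:
  assumes "f \<in> I" "f \<noteq> 0"
  shows "lead_expo lt f \<in> E"
proof (rule ccontr)
  define \<alpha> where "\<alpha> = lead_expo lt f"
  assume "lead_expo lt f \<notin> E"
  then have \<alpha>: "\<alpha> = least_expo (weight a \<alpha>)"
    by (simp add: E_def \<alpha>_def)
  have "weight a \<beta> \<noteq> weight a \<alpha>" if "\<beta> \<in> Poly_Mapping.keys f" "\<beta> \<noteq> \<alpha>" for \<beta>
    using lead_expo(2)[OF assms(2)] that least_expo_least \<alpha> unfolding \<alpha>_def by metis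
  then have "Poly_Mapping.lookup (push (weight a) f) (weight a \<alpha>) =
      (\<Sum>\<beta>\<in>Poly_Mapping.keys f. if \<beta> = \<alpha> then Poly_Mapping.lookup f \<beta> else 0)"
    unfolding push_def lookup_sum
    by (intro sum.cong) (auto simp: lookup_single when_def)
  also have "\<dots> \<noteq> 0"
    using lead_expo(1)[OF assms(2)] by (simp add: \<alpha>_def in_keys_iff)
  finally show False
    using push_weight_ideal[OF assms(1)] by simp
qed

lemma lead_ideal: "lead_expo lt ` (I - {0}) = E"
proof (intro equalityI subsetI)
  fix \<alpha> assume "\<alpha> \<in> E"
  then show "\<alpha> \<in> lead_expo lt ` (I - {0})"
    using binom_in_ideal binom_nonzero lead_binom by (intro image_eqI[of _ _ "binom \<alpha>"]) auto
qed (use lead_in_E in auto)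

section \<open>The minimal elements of \<open>E\<close> under divisibility and the reduced Groebner
  basis\<close>

definition corners :: "'n option expo set" where
  "corners = {\<alpha> \<in> E. \<forall>\<beta>\<in>E. \<forall>\<gamma>. \<alpha> = \<beta> + \<gamma> \<longrightarrow> \<gamma> = 0}"

lemma finite_corners: "finite corners"
  by (rule Dickson) (auto simp: corners_def)

text \<open>Well-founded induction on \<open>lt\<close>: outside \<open>corners\<close>, an element
  of \<open>E\<close> has a proper divisor in \<open>E\<close>, which is smaller.\<close>

lemma corner_below:
  assumes "\<alpha> \<in> E"
  shows "\<exists>\<beta>\<in>corners. \<exists>\<gamma>. \<alpha> = \<beta> + \<gamma>"
  using assms
proof (induction \<alpha> rule: wfp_induct_rule[OF lt_wf])
  case (1 \<alpha>)
  show ?case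
  proof (cases "\<alpha> \<in> corners")
    case True
    then show ?thesis by (metis add.right_neutral)
  next
    case False
    then obtain \<beta> \<gamma> where *: "\<beta> \<in> E" "\<alpha> = \<beta> + \<gamma>" "\<gamma> \<noteq> 0"
      using 1 by (auto simp: corners_def)
    then obtain \<delta> \<epsilon> where "\<delta> \<in> corners" "\<beta> = \<delta> + \<epsilon>"
      using 1 lt_add_right by blast
    then show ?thesis using * by (metis add.assoc)
  qed
qed

lemma lead_binom_corner: "\<alpha> \<in> corners \<Longrightarrow> lead_expo lt (binom \<alpha>) = \<alpha>"
  by (simp add: corners_def lead_binom)

lemma expo_cone_corners: "expo_cone lt (binom ` corners) = E"
proof (intro equalityI subsetI)
  fix \<alpha> assume "\<alpha> \<in> expo_cone lt (binom ` corners)"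
  then obtain \<beta> \<gamma> where "\<beta> \<in> corners" "\<alpha> = \<beta> + \<gamma>"
    by (auto simp: expo_cone_def lead_binom_corner)
  then show "\<alpha> \<in> E"
    using E_add by (simp add: corners_def)
next
  fix \<alpha> assume "\<alpha> \<in> E"
  then show "\<alpha> \<in> expo_cone lt (binom ` corners)"
    using corner_below lead_binom_corner unfolding expo_cone_def by fastforce
qed

text \<open>Leading exponents are minimal in \<open>E\<close>, so none divides another; tails lie
  outside \<open>E\<close>, so no leading exponent divides them.\<close>

lemma is_reduced_groebner_basis_corners: "is_reduced_groebner_basis lt I (binom ` corners)"
  unfolding is_reduced_groebner_basis_def groebner_basis_def
proof (intro conjI ballI)
  show "finite (binom ` corners)"
    using finite_corners by simp
  show "binom ` corners \<subseteq> I - {0}"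
    using binom_in_ideal binom_nonzero by (auto simp: corners_def)
  show "lead_expo lt ` (I - {0}) = expo_cone lt (binom ` corners)"
    by (simp add: lead_ideal expo_cone_corners)
next
  fix g assume "g \<in> binom ` corners"
  then obtain \<alpha> where \<alpha>: "\<alpha> \<in> corners" "g = binom \<alpha>" by blast
  then have E: "\<alpha> \<in> E" by (simp add: corners_def)
  show "Poly_Mapping.lookup g (lead_expo lt g) = 1"
    using \<alpha> E by (simp add: lead_binom lookup_binom)
  have "\<alpha> \<notin> expo_cone lt (binom ` corners - {g})"
  proof
    assume "\<alpha> \<in> expo_cone lt (binom ` corners - {g})"
    then obtain \<beta> \<gamma> where "\<beta> \<in> corners" "binom \<beta> \<noteq> g" "\<alpha> = lead_expo lt (binom \<beta>) + \<gamma>"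
      unfolding expo_cone_iff by blast
    then have "\<beta> \<in> corners" "binom \<beta> \<noteq> binom \<alpha>" "\<alpha> = \<beta> + \<gamma>"
      using \<alpha>(2) lead_binom_corner by simp_all
    then show False using \<alpha> by (auto simp: corners_def)
  qed
  moreover have "least_expo (weight a \<alpha>) \<notin> expo_cone lt (binom ` corners - {g})"
  proof
    assume "least_expo (weight a \<alpha>) \<in> expo_cone lt (binom ` corners - {g})"
    then have "least_expo (weight a \<alpha>) \<in> E"
      using expo_cone_corners unfolding expo_cone_def by blast
    then show False by (simp add: E_def)
  qed
  ultimately show "Poly_Mapping.keys g \<inter> expo_cone lt (binom ` corners - {g}) = {}"
    using \<alpha>(2) keys_binom[OF E] by simp
qed

text \<open>Reducedness makes the leading exponent minimal in \<open>E\<close> and keeps all other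
  exponents of \<open>g\<close> outside \<open>E\<close>. Hence \<open>g\<close> minus the binomial
  is an ideal element supported outside \<open>E\<close>, which must vanish.\<close>

lemma reduced_basis_element:
  assumes G: "is_reduced_groebner_basis lt I G" and g: "g \<in> G"
  shows "lead_expo lt g \<in> corners" and "g = binom (lead_expo lt g)"
proof -
  define \<alpha> where "\<alpha> = lead_expo lt g"
  have gI: "g \<in> I" "g \<noteq> 0" and cone: "expo_cone lt G = E"
    and lc: "Poly_Mapping.lookup g \<alpha> = 1"
    and red: "Poly_Mapping.keys g \<inter> expo_cone lt (G - {g}) = {}"
    using G g lead_ideal by (auto simp: is_reduced_groebner_basis_def groebner_basis_def \<alpha>_def)
  have E: "\<alpha> \<in> E"
    using lead_in_E gI by (simp add: \<alpha>_def)
  \<comment> \<open>Reducedness lets only the leading exponent of \<open>g\<close> itself divide an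
    exponent of \<open>g\<close>.\<close>
  have key: "\<beta> = \<alpha> + \<gamma>" "\<gamma> \<noteq> 0 \<Longrightarrow> lt \<alpha> \<beta>"
    if "\<beta> \<in> Poly_Mapping.keys g" "\<beta> = lead_expo lt h + \<gamma>" "h \<in> G" for \<beta> \<gamma> h
  proof -
    have "h = g"
      using that red by (fastforce simp: expo_cone_def)
    then show "\<beta> = \<alpha> + \<gamma>" "\<gamma> \<noteq> 0 \<Longrightarrow> lt \<alpha> \<beta>"
      using that lt_add_right by (auto simp: \<alpha>_def)
  qed
  show "lead_expo lt g \<in> corners"
    unfolding corners_def \<alpha>_def[symmetric]
  proof (intro CollectI conjI ballI allI impI E)
    fix \<beta> \<gamma> assume "\<beta> \<in> E" and \<alpha>: "\<alpha> = \<beta> + \<gamma>"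
    then obtain h \<delta> where h: "h \<in> G" "\<beta> = lead_expo lt h + \<delta>"
      unfolding cone[symmetric] expo_cone_iff by blast
    then have "\<alpha> = \<alpha> + (\<delta> + \<gamma>)"
      using key(1)[of \<alpha> h "\<delta> + \<gamma>"] \<alpha> lead_expo(1)[OF gI(2)] by (simp add: \<alpha>_def add.assoc)
    then have "\<delta> + \<gamma> = 0" by simp
    show "\<gamma> = 0"
    proof (rule ccontr)
      assume "\<gamma> \<noteq> 0"
      then have "lt \<delta> 0"
        using lt_add_right[of \<gamma> \<delta>] \<open>\<delta> + \<gamma> = 0\<close> by simp
      then show False using lt_zero by simp
    qed
  qed
  have "g - binom \<alpha> = 0"
  proof (rule standard_in_ideal_eq_zero)
    show "g - binom \<alpha> \<in> I"
      using gI binom_in_ideal ideal_diff by blast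
    have "\<beta> \<notin> E" if "\<beta> \<in> Poly_Mapping.keys (g - binom \<alpha>)" for \<beta>
    proof
      assume "\<beta> \<in> E"
      \<comment> \<open>Both leading coefficients are 1, so the leading terms cancel in the
        difference.\<close>
      have "\<beta> \<noteq> \<alpha>"
        using that lc lookup_binom[OF E] by (auto simp: in_keys_iff lookup_minus)
      then have \<beta>: "\<beta> \<in> Poly_Mapping.keys g"
        using that \<open>\<beta> \<in> E\<close> keys_diff[of g "binom \<alpha>"] keys_binom[OF E] by (auto simp: E_def)
      obtain h \<gamma> where h: "h \<in> G" "\<beta> = lead_expo lt h + \<gamma>"
        using \<open>\<beta> \<in> E\<close> unfolding cone[symmetric] expo_cone_iff by blast
      \<comment> \<open>An exponent of \<open>g\<close> in \<open>E\<close> other than \<alpha> is a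
        proper multiple of \<alpha>, hence above it, although \<alpha> is the leading one.\<close>
      have "lt \<alpha> \<beta>"
        using key[OF \<beta> h(2,1)] \<open>\<beta> \<noteq> \<alpha>\<close> by fastforce
      moreover have "lt \<beta> \<alpha>"
        using lead_expo(2)[OF gI(2) \<beta>] \<open>\<beta> \<noteq> \<alpha>\<close> by (simp add: \<alpha>_def)
      ultimately show False
        using lt_trans lt_irrefl by blast
    qed
    then show "Poly_Mapping.keys (g - binom \<alpha>) \<subseteq> - E" by blast
  qed
  then show "g = binom (lead_expo lt g)" by (simp add: \<alpha>_def)
qed

text \<open>In any reduced basis all elements are corner binomials. Conversely each corner is
  divisible by a leading exponent of the basis and, being minimal, equals it.\<close>

lemma reduced_groebner_basis_eq: "reduced_groebner_basis lt I = binom ` corners"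
  unfolding reduced_groebner_basis_def
proof (rule the_equality)
  show "is_reduced_groebner_basis lt I (binom ` corners)"
    by (rule is_reduced_groebner_basis_corners)
next
  fix G assume G: "is_reduced_groebner_basis lt I G"
  then have cone: "expo_cone lt G = E"
    using lead_ideal by (simp add: is_reduced_groebner_basis_def groebner_basis_def)
  have "binom \<alpha> \<in> G" if "\<alpha> \<in> corners" for \<alpha>
  proof -
    have "\<alpha> \<in> expo_cone lt G"
      using that cone by (simp add: corners_def)
    then obtain g \<gamma> where g: "g \<in> G" "\<alpha> = lead_expo lt g + \<gamma>"
      unfolding expo_cone_iff by blast
    then have "lead_expo lt g \<in> E"
      using reduced_basis_element(1)[OF G] by (simp add: corners_def)
    then have "\<alpha> = lead_expo lt g"
      using that g(2) by (auto simp: corners_def)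
    then show ?thesis
      using reduced_basis_element(2)[OF G g(1)] g(1) by simp
  qed
  then show "G = binom ` corners"
    using reduced_basis_element[OF G] by blast
qed

section \<open>Reduction of monomials and their normal forms\<close>

lemma reduction_step_monomial:
  "reduction_step lt (binom ` corners) (monomial \<alpha>) h \<longleftrightarrow>
     (\<exists>\<beta>\<in>corners. \<exists>\<gamma>. \<alpha> = \<beta> + \<gamma> \<and> h = monomial (least_expo (weight a \<beta>) + \<gamma>))"
proof -
  have "lead_expo lt (binom \<beta>) + \<gamma> \<in> Poly_Mapping.keys (monomial \<alpha>) \<and>
        h = monomial \<alpha> - Poly_Mapping.single \<gamma>
              (Poly_Mapping.lookup (monomial \<alpha>) (lead_expo lt (binom \<beta>) + \<gamma>) /
               Poly_Mapping.lookup (binom \<beta>) (lead_expo lt (binom \<beta>))) * binom \<beta> \<longleftrightarrow>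
      \<alpha> = \<beta> + \<gamma> \<and> h = monomial (least_expo (weight a \<beta>) + \<gamma>)"
    if "\<beta> \<in> corners" for \<beta> \<gamma>
  proof (cases "\<alpha> = \<beta> + \<gamma>")
    case True
    \<comment> \<open>The only term cancels against the leading term of the shifted binomial, and
      the shifted tail remains: monomials reduce to monomials.\<close>
    have "monomial (\<beta> + \<gamma>) - monomial \<gamma> * binom \<beta> = monomial (least_expo (weight a \<beta>) + \<gamma>)"
      by (simp add: binom_def monomial_add algebra_simps)
    moreover have "Poly_Mapping.lookup (binom \<beta>) \<beta> = 1"
      using that by (simp add: corners_def lookup_binom)
    ultimately show ?thesis
      using True by (simp add: lead_binom_corner[OF that])
  next
    case False
    then show ?thesis by (auto simp: lead_binom_corner[OF that])
  qed
  then show ?thesis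
    unfolding reduction_step_def by blast
qed

lemma irreducible_monomial_iff: "(\<nexists>h. reduction_step lt (binom ` corners) (monomial \<alpha>) h) \<longleftrightarrow> \<alpha> \<notin> E"
  using corner_below[of \<alpha>] E_add unfolding reduction_step_monomial by (auto simp: corners_def)

text \<open>Each step exchanges a factor for another of the same weight.\<close>

lemma reduction_steps_monomial:
  assumes "(reduction_step lt (binom ` corners))\<^sup>*\<^sup>* (monomial \<alpha>) h"
  shows "\<exists>\<beta>. h = monomial \<beta> \<and> weight a \<beta> = weight a \<alpha>"
  using assms
proof (induction rule: rtranclp_induct)
  case (step h h')
  then obtain \<delta> where \<delta>: "h = monomial \<delta>" "weight a \<delta> = weight a \<alpha>"
    by blast
  then have "reduction_step lt (binom ` corners) (monomial \<delta>) h'"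
    using step.hyps(2) by simp
  then obtain \<beta> \<gamma> where "\<delta> = \<beta> + \<gamma>" "h' = monomial (least_expo (weight a \<beta>) + \<gamma>)"
    unfolding reduction_step_monomial by blast
  then show ?case
    using \<delta> by (intro exI[of _ "least_expo (weight a \<beta>) + \<gamma>"]) simp
qed blast

text \<open>A step strictly lowers the monomial, so induction on \<open>lt\<close> applies; a
  monomial outside \<open>E\<close> is already the least of its weight.\<close>

lemma reduction_steps_least:
  "(reduction_step lt (binom ` corners))\<^sup>*\<^sup>* (monomial \<alpha>) (monomial (least_expo (weight a \<alpha>)))"
proof (induction \<alpha> rule: wfp_induct_rule[OF lt_wf])
  case (1 \<alpha>)
  show ?case
  proof (cases "\<alpha> \<in> E")
    case True
    then obtain \<beta> \<gamma> where \<beta>: "\<beta> \<in> corners" "\<alpha> = \<beta> + \<gamma>"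
      using corner_below by blast
    define \<delta> where "\<delta> = least_expo (weight a \<beta>) + \<gamma>"
    have "lt \<delta> \<alpha>"
      using \<beta> lt_add by (simp add: \<delta>_def corners_def E_iff)
    moreover have "reduction_step lt (binom ` corners) (monomial \<alpha>) (monomial \<delta>)"
      unfolding reduction_step_monomial using \<beta> \<delta>_def by blast
    moreover have "weight a \<delta> = weight a \<alpha>"
      using \<beta> by (simp add: \<delta>_def)
    ultimately show ?thesis
      using 1[of \<delta>] by (metis converse_rtranclp_into_rtranclp)
  next
    case False
    then show ?thesis by (simp add: E_def)
  qed
qed

text \<open>Uniqueness holds because every irreducible result is a monomial outside \<open>E\<close>
  of the original weight, and only one such monomial exists.\<close>

lemma normal_form_monomial:
  "normal_form lt (binom ` corners) (monomial \<alpha>) = monomial (least_expo (weight a \<alpha>))"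
  unfolding normal_form_def
proof (rule the_equality)
  show "(reduction_step lt (binom ` corners))\<^sup>*\<^sup>* (monomial \<alpha>) (monomial (least_expo (weight a \<alpha>))) \<and>
      (\<nexists>h. reduction_step lt (binom ` corners) (monomial (least_expo (weight a \<alpha>))) h)"
    using reduction_steps_least irreducible_monomial_iff by (simp add: E_def)
next
  fix h assume h: "(reduction_step lt (binom ` corners))\<^sup>*\<^sup>* (monomial \<alpha>) h \<and>
      (\<nexists>h'. reduction_step lt (binom ` corners) h h')"
  then obtain \<beta> where \<beta>: "h = monomial \<beta>" "weight a \<beta> = weight a \<alpha>"
    using reduction_steps_monomial by blast
  then have "\<beta> \<notin> E"
    using h irreducible_monomial_iff by blast
  then show "h = monomial (least_expo (weight a \<alpha>))"
    using \<beta> by (simp add: E_def)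
qed

lemma Apery_Delta_eq:
  "Apery_Delta lt a j = {n. Poly_Mapping.lookup (least_expo n) None = 0 \<and>
     Poly_Mapping.lookup (least_expo n) (Some j) = 0}"
proof -
  have "lead_expo lt (monomial \<alpha>) = \<alpha>" for \<alpha>
    by (rule lead_expo_eqI) auto
  moreover have "least_expo n \<notin> E" for n
    by (simp add: E_def)
  ultimately show ?thesis
    unfolding Apery_Delta_def Let_def reduced_groebner_basis_eq
    by (simp add: qvar_power normal_form_monomial expo_cone_corners)
qed

end

section \<open>The Apery ordering\<close>

lemma Apery_ordering_lt_None:
  assumes "Apery_ordering a j lt" "Poly_Mapping.lookup \<alpha> None < Poly_Mapping.lookup \<beta> None"
  shows "lt \<alpha> \<beta>"
  using assms unfolding Apery_ordering_def Let_def by blast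

lemma Apery_ordering_lt_weight:
  assumes "Apery_ordering a j lt" "Poly_Mapping.lookup \<alpha> None = Poly_Mapping.lookup \<beta> None"
    and "weight_except a j \<alpha> < weight_except a j \<beta>"
  shows "lt \<alpha> \<beta>"
  using assms unfolding Apery_ordering_def Let_def by blast

text \<open>The exponents of a monomial free of \<open>x\<close> are the coefficients of a
  combination of the generators.\<close>

lemma generated_monoid_iff:
  fixes a :: "'n::finite \<Rightarrow> nat"
  shows "n \<in> generated_monoid a \<longleftrightarrow> (\<exists>\<alpha>. Poly_Mapping.lookup \<alpha> None = 0 \<and> weight a \<alpha> = n)"
proof
  assume "n \<in> generated_monoid a"
  then obtain c where c: "n = (\<Sum>i\<in>UNIV. c i * a i)"
    by (auto simp: generated_monoid_def)
  define \<alpha> where "\<alpha> = Abs_poly_mapping (case_option 0 c)"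
  have "Poly_Mapping.lookup \<alpha> = case_option 0 c"
    unfolding \<alpha>_def by (rule lookup_Abs_poly_mapping) simp
  then show "\<exists>\<alpha>. Poly_Mapping.lookup \<alpha> None = 0 \<and> weight a \<alpha> = n"
    using c by (intro exI[of _ \<alpha>]) (simp add: weight_def)
qed (auto simp: generated_monoid_def weight_def)

theorem theorem6:
  fixes a :: "'n::finite \<Rightarrow> nat"
    and j :: 'n
    and lt :: "'n option expo \<Rightarrow> 'n option expo \<Rightarrow> bool"
  assumes "Gcd (range a) = 1"
    and "\<forall>i. a i \<noteq> 0"
    and "Apery_ordering a j lt"
  shows "Apery_Delta lt a j = Apery_set (generated_monoid a) (a j)"
proof -
  interpret monoid_ordering lt a
    by unfold_locales (use assms(3) in \<open>simp add: Apery_ordering_def\<close>)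
  let ?S = "generated_monoid a"
  have Apery: "Apery_set ?S (a j) = {n \<in> ?S. \<nexists>m. m \<in> ?S \<and> n = m + a j}"
    using assms(1,2) by (intro Apery_set_eq generated_monoid_zero generated_monoid_add
      generated_monoid_generator generated_monoid_cong) auto
  \<comment> \<open>By the first criterion a monomial free of \<open>x\<close> lies below every
    monomial of the same weight that contains \<open>x\<close>.\<close>
  have None_iff: "Poly_Mapping.lookup (least_expo n) None = 0 \<longleftrightarrow> n \<in> ?S" for n
  proof
    assume "n \<in> ?S"
    then obtain \<alpha> where "Poly_Mapping.lookup \<alpha> None = 0" "weight a \<alpha> = n"
      by (auto simp: generated_monoid_iff)
    then show "Poly_Mapping.lookup (least_expo n) None = 0"
      using least_expo_least[of \<alpha> n] Apery_ordering_lt_None[OF assms(3), of \<alpha> "least_expo n"] by auto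
  next
    assume "Poly_Mapping.lookup (least_expo n) None = 0"
    then show "n \<in> ?S"
      unfolding generated_monoid_iff using weight_least_expo by blast
  qed
  have "Poly_Mapping.lookup (least_expo n) (Some j) = 0 \<longleftrightarrow> (\<nexists>m. m \<in> ?S \<and> n = m + a j)"
    if n: "Poly_Mapping.lookup (least_expo n) None = 0" for n
  proof (intro iffI notI)
    assume j: "Poly_Mapping.lookup (least_expo n) (Some j) = 0"
    assume "\<exists>m. m \<in> ?S \<and> n = m + a j"
    then obtain \<alpha> where \<alpha>: "Poly_Mapping.lookup \<alpha> None = 0" "n = weight a \<alpha> + a j"
      by (auto simp: generated_monoid_iff)
    \<comment> \<open>Multiplying a monomial of weight \<open>n - a j\<close> by \<open>y_j\<close>
      gives a competitor of weight \<open>n\<close>. Part of its weight sits in \<open>y_j\<close>,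
      so the second criterion places it below a monomial free of \<open>x\<close> and
      \<open>y_j\<close>.\<close>
    define \<beta> where "\<beta> = \<alpha> + Poly_Mapping.single (Some j) 1"
    have \<beta>: "Poly_Mapping.lookup \<beta> None = 0" "Poly_Mapping.lookup \<beta> (Some j) > 0" "weight a \<beta> = n"
      using \<alpha> by (simp_all add: \<beta>_def lookup_add lookup_single)
    then have "0 < Poly_Mapping.lookup \<beta> (Some j) * a j"
      using assms(2) by simp
    then have "weight_except a j \<beta> < n"
      using weight_eq_weight_except[of a \<beta> j] \<beta>(3) by linarith
    also have "n = weight_except a j (least_expo n)"
      using weight_eq_weight_except[of a "least_expo n" j] n j by simp
    finally have "lt \<beta> (least_expo n)"
      using Apery_ordering_lt_weight[OF assms(3)] \<beta>(1) n by simp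
    then show False
      using least_expo_least \<beta>(3) by blast
  next
    assume no: "\<nexists>m. m \<in> ?S \<and> n = m + a j"
    define \<alpha> where "\<alpha> = least_expo n - Poly_Mapping.single (Some j) 1"
    show "Poly_Mapping.lookup (least_expo n) (Some j) = 0"
    proof (rule ccontr)
      assume "Poly_Mapping.lookup (least_expo n) (Some j) \<noteq> 0"
      \<comment> \<open>The truncated subtraction in \<alpha> is exact because the exponent of
        \<open>y_j\<close> is positive.\<close>
      then have "least_expo n = \<alpha> + Poly_Mapping.single (Some j) 1"
        by (intro poly_mapping_eqI) (auto simp: \<alpha>_def lookup_add lookup_minus lookup_single when_def)
      then have "n = weight a \<alpha> + a j"
        using weight_least_expo[of n] by simp
      moreover have "weight a \<alpha> \<in> ?S"
        using n by (auto simp: generated_monoid_iff \<alpha>_def lookup_minus lookup_single intro!: exI[of _ \<alpha>])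
      ultimately show False using no by blast
    qed
  qed
  then show ?thesis
    unfolding Apery Apery_Delta_eq using None_iff by blast
qed

end
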